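(* Let $n\ge 1$ and $\lambda>0$. For every fixed $x\in\mathbb{R}^n\setminus\{0\}$, $$G^\lambda_\alpha(x)=\lambda^{-\alpha}\,p_{\alpha/\lambda}(x)\,\bigl(1+O(\alpha^{-1})\bigr),\qquad \alpha\to\infty.$$ Equivalently, $$G^\lambda_\alpha(x)=\lambda^{-\alpha}\,(4\pi\alpha/\lambda)^{-n/2}\exp\Bigl(-\frac{\lambda|x|^2}{4\alpha}\Bigr)\bigl(1+O(\alpha^{-1})\bigr),\qquad \alpha\to\infty.$$ Moreover, the $O(\alpha^{-1})$ error is uniform for $x$ in compact subsets of $\mathbb{R}^n$.
   Context: The Fourier transform on $\mathbb{R}^n$ is $\widehat f(\xi)=\int_{\mathbb{R}^n}f(x)e^{-2\pi i x\cdot\xi}\,dx$, extended to tempered distributions. The Gaussian heat kernel is $p_t(x)=(4\pi t)^{-n/2}e^{-|x|^2/(4t)}$ for $t>0$, $x\in\mathbb{R}^n$. For $\alpha>0$, $\lambda>0$, $G^\lambda_\alpha$ denotes the shifted Bessel kernel, i.e. the tempered distribution with Fourier transform $\widehat{G^\lambda_\alpha}(\xi)=(\lambda+4\pi^2|\xi|^2)^{-\alpha}$; it is the function given pointwise by $$G^\lambda_\alpha(x)=\frac{1}{\Gamma(\alpha)}\int_0^\infty e^{-\lambda t}\,t^{\alpha-1}\,p_t(x)\,dt .$$ *)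

theory Defs
  imports "HOL-Probability.Probability" "HOL-Library.Landau_Symbols"
begin

definition heat_kernel :: "real \<Rightarrow> real ^ 'n \<Rightarrow> real" where
  "heat_kernel t x = (4 * pi * t) powr (- real CARD('n) / 2) * exp (- ((norm x)\<^sup>2 / (4 * t)))"

text \<open>The integral diverges exactly when \<open>x = 0\<close> and \<open>\<alpha> \<le> CARD('n) / 2\<close>; there the library convention
  gives the value 0. The lemma \<open>fourier_shifted_bessel_kernel\<close> below shows that this function is
  integrable with Fourier transform \<open>(lambda + 4 * pi\<^sup>2 * (norm \<xi>)\<^sup>2) powr (- \<alpha>)\<close>, so it represents the
  tempered distribution that defines the kernel.\<close>

definition shifted_bessel_kernel :: "real \<Rightarrow> real \<Rightarrow> real ^ 'n \<Rightarrow> real" where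
  "shifted_bessel_kernel lambda \<alpha> x =
     1 / Gamma \<alpha> * (LBINT t:{0<..}. exp (- lambda * t) * t powr (\<alpha> - 1) * heat_kernel t x)"

lemma has_bochner_integral_gaussian_cis:
  fixes t s :: real
  assumes "t > 0"
  shows "has_bochner_integral lborel
    (\<lambda>x. complex_of_real ((4 * pi * t) powr (- 1 / 2) * exp (- (x\<^sup>2 / (4 * t)))) * cis (- 2 * pi * (x * s)))
    (complex_of_real (exp (- (4 * pi\<^sup>2 * t * s\<^sup>2))))" (is "has_bochner_integral _ ?f ?v")
proof -
  define c where "c = sqrt (2 * t)"
  define u where "u = - 2 * pi * s * c"
  have c: "c > 0" "c\<^sup>2 = 2 * t" using assms by (auto simp: c_def)
  have sq: "(4 * pi * t) powr (- 1 / 2) = 1 / (sqrt (2 * pi) * c)"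
  proof -
    have "(4 * pi * t) powr (- 1 / 2) = 1 / sqrt (4 * pi * t)"
      using assms powr_minus_divide[of "4 * pi * t" "1/2"] by (simp add: powr_half_sqrt)
    also have "sqrt (4 * pi * t) = sqrt (2 * pi) * c"
    proof -
      have "4 * pi * t = (2 * pi) * (2 * t)" by simp
      thus ?thesis unfolding c_def by (metis real_sqrt_mult)
    qed
    finally show ?thesis .
  qed
  have eq: "c *\<^sub>R ?f (0 + c * x) = std_normal_density x *\<^sub>R iexp (u * x)" for x
  proof -
    have "(c * x)\<^sup>2 / (4 * t) = x\<^sup>2 / 2" using assms c by (simp add: power_mult_distrib)
    moreover have "cis (- 2 * pi * ((c * x) * s)) = iexp (u * x)"
      by (simp add: cis_conv_exp u_def mult_ac)
    ultimately show ?thesis using c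
      unfolding std_normal_density_def sq add_0_left by (simp add: scaleR_conv_of_real)
  qed
  have int: "integrable lborel (\<lambda>x. std_normal_density x *\<^sub>R iexp (u * x))"
    by (rule Bochner_Integration.integrable_bound[OF integrable_normal_density[of 1 0]])
       (auto simp: norm_mult)
  have "u\<^sup>2 / 2 = 4 * pi\<^sup>2 * t * s\<^sup>2" unfolding u_def using c by (simp add: power_mult_distrib)
  hence val: "(\<integral>x. std_normal_density x *\<^sub>R iexp (u * x) \<partial>lborel) = ?v"
    using fun_cong[OF char_std_normal_distribution, of u]
    by (simp add: char_def integral_density normal_density_nonneg)
  have hb: "has_bochner_integral lborel (\<lambda>x. c *\<^sub>R ?f (0 + c * x)) ?v"
    unfolding eq using has_bochner_integral_integrable[OF int] val by simp
  have "has_bochner_integral lborel (\<lambda>x. inverse c *\<^sub>R (c *\<^sub>R ?f (0 + c * x))) (inverse c *\<^sub>R ?v)"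
    by (rule has_bochner_integral_scaleR_right) (rule hb)
  moreover have "inverse c *\<^sub>R (c *\<^sub>R z) = z" for z :: complex using c by simp
  moreover have "\<bar>c\<bar> = c" "c \<noteq> 0" using c by auto
  ultimately show ?thesis
    using lborel_has_bochner_integral_real_affine_iff[of c ?f ?v 0] by (simp only: simp_thms not_False_eq_True)
qed

lemma has_bochner_integral_heat_kernel_cis:
  fixes \<xi> :: "real ^ 'n"
  assumes "t > 0"
  shows "has_bochner_integral lborel
    (\<lambda>x. complex_of_real (heat_kernel t x) * cis (- 2 * pi * (x \<bullet> \<xi>)))
    (complex_of_real (exp (- (4 * pi\<^sup>2 * t * (norm \<xi>)\<^sup>2))))"
proof -
  define g where "g b y = complex_of_real ((4 * pi * t) powr (- 1 / 2) * exp (- (y\<^sup>2 / (4 * t))))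
     * cis (- 2 * pi * (y * (\<xi> \<bullet> b)))" for b :: "real ^ 'n" and y
  interpret product_sigma_finite "\<lambda>_::real^'n. lborel :: real measure" ..
  have g: "has_bochner_integral lborel (g b) (complex_of_real (exp (- (4 * pi\<^sup>2 * t * (\<xi> \<bullet> b)\<^sup>2))))" for b
    unfolding g_def by (rule has_bochner_integral_gaussian_cis[OF assms])
  have [measurable]: "g b \<in> borel_measurable borel" for b
    using borel_measurable_has_bochner_integral[OF g] by simp
  have nrm: "(norm x)\<^sup>2 = (\<Sum>b\<in>Basis. (x \<bullet> b)\<^sup>2)" for x :: "real^'n"
    unfolding power2_norm_eq_inner by (subst euclidean_inner) (simp add: power2_eq_square)
  have cis_sum: "cis (sum h A) = (\<Prod>b\<in>A. cis (h b))" for h and A :: "(real^'n) set"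
    by (induction A rule: infinite_finite_induct) (auto simp: cis_mult[symmetric])
  have prod: "complex_of_real (heat_kernel t x) * cis (- 2 * pi * (x \<bullet> \<xi>)) = (\<Prod>b\<in>Basis. g b (x \<bullet> b))" for x
  proof -
    have 1: "(4 * pi * t) powr (- real CARD('n) / 2) = (\<Prod>b\<in>(Basis::(real^'n) set). (4 * pi * t) powr (- 1 / 2))"
      using assms by (simp add: powr_realpow[symmetric] powr_powr)
    have 2: "exp (- ((norm x)\<^sup>2 / (4 * t))) = (\<Prod>b\<in>Basis. exp (- ((x \<bullet> b)\<^sup>2 / (4 * t))))"
      by (simp add: nrm exp_sum[symmetric] sum_negf sum_divide_distrib)
    have 3: "cis (- 2 * pi * (x \<bullet> \<xi>)) = (\<Prod>b\<in>Basis. cis (- 2 * pi * ((x \<bullet> b) * (\<xi> \<bullet> b))))"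
      by (simp add: euclidean_inner[of x \<xi>] sum_distrib_left cis_sum[symmetric] sum_negf)
    show ?thesis unfolding heat_kernel_def g_def 1 2 3
      by (simp only: prod.distrib of_real_mult of_real_prod)
  qed
  have proj: "(\<Sum>b\<in>Basis. f b *\<^sub>R b) \<bullet> c = f c" if "c \<in> Basis" for f and c :: "real^'n"
    using that by simp
  have cong: "(\<Prod>c\<in>Basis. g c ((\<Sum>b\<in>Basis. f b *\<^sub>R b) \<bullet> c)) = (\<Prod>c\<in>Basis. g c (f c))" for f
    by (intro prod.cong refl) (simp only: proj)
  have "integrable lborel (\<lambda>x. \<Prod>b\<in>Basis. g b (x \<bullet> b))"
    by (subst lborel_eq, subst integrable_distr_eq)
       (auto simp only: cong intro!: product_integrable_prod has_bochner_integral_integrable g[THEN integrable.intros], measurable)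
  moreover have "(\<integral>x. (\<Prod>b\<in>Basis. g b (x \<bullet> b)) \<partial>lborel) = complex_of_real (exp (- (4 * pi\<^sup>2 * t * (norm \<xi>)\<^sup>2)))"
  proof -
    have "(\<integral>x. (\<Prod>b\<in>Basis. g b (x \<bullet> b)) \<partial>lborel)
       = (\<integral>f. (\<Prod>c\<in>Basis. g c (f c)) \<partial>(\<Pi>\<^sub>M b\<in>Basis. lborel))"
      by (subst lborel_eq, subst integral_distr) (auto simp only: cong, measurable)
    also have "\<dots> = (\<Prod>b\<in>Basis. integral\<^sup>L lborel (g b))"
      by (rule product_integral_prod) (auto intro: g[THEN integrable.intros])
    also have "\<dots> = complex_of_real (exp (- (4 * pi\<^sup>2 * t * (norm \<xi>)\<^sup>2)))"
      by (simp add: has_bochner_integral_integral_eq[OF g] nrm sum_distrib_left exp_sum[symmetric] sum_negf of_real_prod[symmetric] del: of_real_prod)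
    finally show ?thesis .
  qed
  ultimately show ?thesis unfolding prod by (simp add: has_bochner_integral_iff)
qed

lemma has_bochner_integral_Gamma_scaled:
  fixes \<alpha> s :: real
  assumes "\<alpha> > 0" "s > 0"
  shows "has_bochner_integral lborel
    (\<lambda>t. indicator {0<..} t * (exp (- s * t) * t powr (\<alpha> - 1))) (Gamma \<alpha> * s powr (- \<alpha>))"
    (is "has_bochner_integral _ ?f _")
proof -
  have "has_bochner_integral lborel (\<lambda>t. indicator {0..} t * t powr (\<alpha> - 1) / exp t) (Gamma \<alpha>)"
    using Gamma_conv_nn_integral_real[OF assms(1)] assms Gamma_real_pos[of \<alpha>]
    by (intro has_bochner_integral_nn_integral) auto
  hence "has_bochner_integral lborel (\<lambda>t. indicator {0..} (0 + s * t) * (0 + s * t) powr (\<alpha> - 1) / exp (0 + s * t)) (Gamma \<alpha> /\<^sub>R \<bar>s\<bar>)"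
    by (subst (asm) lborel_has_bochner_integral_real_affine_iff[of s _ _ 0]) (use assms in auto)
  also have "(\<lambda>t. indicator {0..} (0 + s * t) * (0 + s * t) powr (\<alpha> - 1) / exp (0 + s * t)) = (\<lambda>t. s powr (\<alpha> - 1) * ?f t)"
    using assms by (auto simp: fun_eq_iff indicator_def powr_mult exp_minus field_simps zero_le_mult_iff)
  finally have "has_bochner_integral lborel (\<lambda>t. s powr (1 - \<alpha>) * (s powr (\<alpha> - 1) * ?f t)) (s powr (1 - \<alpha>) * (Gamma \<alpha> /\<^sub>R \<bar>s\<bar>))"
    by (rule has_bochner_integral_mult_right)
  moreover have "s powr (1 - \<alpha>) * (s powr (\<alpha> - 1) * y) = y" for y
    using assms by (simp add: mult.assoc[symmetric] powr_add[symmetric])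
  moreover have "s powr (1 - \<alpha>) * (Gamma \<alpha> /\<^sub>R \<bar>s\<bar>) = Gamma \<alpha> * s powr (- \<alpha>)"
    using assms powr_diff[of s "-\<alpha>" "-1"] by (simp add: field_simps powr_diff powr_minus)
  ultimately show ?thesis by (simp only:)
qed

lemma fourier_shifted_bessel_kernel:
  fixes \<xi> :: "real ^ 'n"
  assumes "lambda > 0" "\<alpha> > 0"
  shows "integrable lborel (shifted_bessel_kernel lambda \<alpha> :: real ^ 'n \<Rightarrow> real)"
    and "(\<integral>x. complex_of_real (shifted_bessel_kernel lambda \<alpha> x) * cis (- 2 * pi * (x \<bullet> \<xi>)) \<partial>lborel)
         = complex_of_real ((lambda + 4 * pi\<^sup>2 * (norm \<xi>)\<^sup>2) powr (- \<alpha>))"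
proof -
  define w where "w t = indicator {0<..} t * (exp (- lambda * t) * t powr (\<alpha> - 1))" for t :: real
  define F where "F \<xi> t x = complex_of_real (w t * heat_kernel t x) * cis (- 2 * pi * (x \<bullet> \<xi>))"
    for \<xi> x :: "real^'n" and t
  have [measurable]: "w \<in> borel_measurable borel" unfolding w_def by measurable
  have w: "integrable lborel w"
    using has_bochner_integral_Gamma_scaled[OF assms(2,1)] unfolding w_def by (rule integrable.intros)
  have hkm[measurable]: "(\<lambda>(t, x::real^'n). heat_kernel t x) \<in> borel_measurable (lborel \<Otimes>\<^sub>M lborel)"
    unfolding heat_kernel_def by measurable
  have cism: "(\<lambda>x. cis (- 2 * pi * (x \<bullet> \<xi>))) \<in> borel_measurable borel" for \<xi> :: "real^'n"
    by (intro borel_measurable_continuous_onI continuous_intros)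
  have Fm: "case_prod (F \<xi>) \<in> borel_measurable (lborel \<Otimes>\<^sub>M lborel)" for \<xi>
    unfolding F_def using cism[of \<xi>, measurable] by measurable
  have inner: "has_bochner_integral lborel (F \<xi> t) (complex_of_real (w t * exp (- (4 * pi\<^sup>2 * t * (norm \<xi>)\<^sup>2))))" for \<xi> t
  proof (cases "t > 0")
    case True
    show ?thesis
      using has_bochner_integral_mult_right[OF has_bochner_integral_heat_kernel_cis[OF True, of \<xi>], of "complex_of_real (w t)"]
      by (simp add: F_def[abs_def] mult.assoc)
  next
    case False
    thus ?thesis by (simp add: F_def[abs_def] w_def has_bochner_integral_zero)
  qed
  have w_nn: "w t \<ge> 0" for t by (auto simp: w_def indicator_def)
  have hk_nn: "heat_kernel t x \<ge> 0" for t and x :: "real^'n" by (simp add: heat_kernel_def)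
  have nF: "complex_of_real (norm (F \<xi> t x)) = F 0 t x" for \<xi> t x
    using w_nn[of t] hk_nn[of t x] by (simp add: F_def norm_mult)
  have nint: "(\<integral>x. norm (F \<xi> t x) \<partial>lborel) = w t" for \<xi> t
    using has_bochner_integral_integral_eq[OF inner[of 0 t]] unfolding nF[of \<xi>, symmetric]
    by simp
  have Fint: "integrable (lborel \<Otimes>\<^sub>M lborel) (case_prod (F \<xi>))" for \<xi>
  proof (rule lborel_pair.Fubini_integrable[OF Fm])
    show "integrable lborel (\<lambda>t. \<integral>x. norm (case_prod (F \<xi>) (t, x)) \<partial>lborel)"
      by (simp add: nint w)
    show "AE t in lborel. integrable lborel (\<lambda>x. case_prod (F \<xi>) (t, x))"
      using inner[THEN integrable.intros] by simp
  qed
  have G: "(\<integral>t. F \<xi> t x \<partial>lborel)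
    = complex_of_real (Gamma \<alpha>) * (complex_of_real (shifted_bessel_kernel lambda \<alpha> x) * cis (- 2 * pi * (x \<bullet> \<xi>)))" for \<xi> x
  proof -
    have "(\<integral>t. F \<xi> t x \<partial>lborel) = complex_of_real (\<integral>t. w t * heat_kernel t x \<partial>lborel) * cis (- 2 * pi * (x \<bullet> \<xi>))"
      unfolding F_def by (subst integral_mult_left_zero) (simp only: integral_complex_of_real)
    also have "(\<integral>t. w t * heat_kernel t x \<partial>lborel) = Gamma \<alpha> * shifted_bessel_kernel lambda \<alpha> x"
      using Gamma_real_pos[OF assms(2)]
      by (simp add: shifted_bessel_kernel_def set_lebesgue_integral_def w_def mult.assoc)
    finally show ?thesis by simp
  qed
  have Gnz: "Gamma \<alpha> \<noteq> 0" using Gamma_real_pos[OF assms(2)] by simp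
  have "integrable lborel (\<lambda>x. inverse (complex_of_real (Gamma \<alpha>)) * (\<integral>t. F 0 t x \<partial>lborel))"
    by (intro integrable_mult_right lborel_pair.integrable_snd[OF Fint[of 0]])
  also have "(\<lambda>x. inverse (complex_of_real (Gamma \<alpha>)) * (\<integral>t. F 0 t x \<partial>lborel))
    = (\<lambda>x. complex_of_real (shifted_bessel_kernel lambda \<alpha> x))"
    unfolding G using Gnz by (simp add: fun_eq_iff)
  finally have "integrable lborel (\<lambda>x::real^'n. complex_of_real (shifted_bessel_kernel lambda \<alpha> x))" .
  from integrable_Re[OF this]
  show "integrable lborel (shifted_bessel_kernel lambda \<alpha> :: real ^ 'n \<Rightarrow> real)"
    by simp
  have "complex_of_real (Gamma \<alpha>) * (\<integral>x. complex_of_real (shifted_bessel_kernel lambda \<alpha> x) * cis (- 2 * pi * (x \<bullet> \<xi>)) \<partial>lborel)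
     = (\<integral>x. (\<integral>t. F \<xi> t x \<partial>lborel) \<partial>lborel)"
    unfolding G by simp
  also have "\<dots> = (\<integral>t. (\<integral>x. F \<xi> t x \<partial>lborel) \<partial>lborel)"
    by (rule lborel_pair.Fubini_integral[OF Fint])
  also have "\<dots> = (\<integral>t. complex_of_real (w t * exp (- (4 * pi\<^sup>2 * t * (norm \<xi>)\<^sup>2))) \<partial>lborel)"
    by (simp only: has_bochner_integral_integral_eq[OF inner])
  also have "\<dots> = complex_of_real (\<integral>t. w t * exp (- (4 * pi\<^sup>2 * t * (norm \<xi>)\<^sup>2)) \<partial>lborel)"
    by (rule integral_complex_of_real)
  also have "(\<lambda>t. w t * exp (- (4 * pi\<^sup>2 * t * (norm \<xi>)\<^sup>2)))
     = (\<lambda>t. indicator {0<..} t * (exp (- (lambda + 4 * pi\<^sup>2 * (norm \<xi>)\<^sup>2) * t) * t powr (\<alpha> - 1)))"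
  proof
    fix t :: real
    have "- (lambda + 4 * pi\<^sup>2 * (norm \<xi>)\<^sup>2) * t = - lambda * t + - (4 * pi\<^sup>2 * t * (norm \<xi>)\<^sup>2)"
      by (simp add: algebra_simps)
    hence "exp (- (lambda + 4 * pi\<^sup>2 * (norm \<xi>)\<^sup>2) * t)
        = exp (- lambda * t) * exp (- (4 * pi\<^sup>2 * t * (norm \<xi>)\<^sup>2))"
      by (simp only: exp_add)
    thus "w t * exp (- (4 * pi\<^sup>2 * t * (norm \<xi>)\<^sup>2))
        = indicator {0<..} t * (exp (- (lambda + 4 * pi\<^sup>2 * (norm \<xi>)\<^sup>2) * t) * t powr (\<alpha> - 1))"
      by (simp only: w_def mult_ac)
  qed
  also have "integral\<^sup>L lborel \<dots> = Gamma \<alpha> * (lambda + 4 * pi\<^sup>2 * (norm \<xi>)\<^sup>2) powr (- \<alpha>)"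
    by (rule has_bochner_integral_integral_eq[OF has_bochner_integral_Gamma_scaled])
       (use assms in \<open>auto intro: add_pos_nonneg\<close>)
  finally show "(\<integral>x. complex_of_real (shifted_bessel_kernel lambda \<alpha> x) * cis (- 2 * pi * (x \<bullet> \<xi>)) \<partial>lborel)
         = complex_of_real ((lambda + 4 * pi\<^sup>2 * (norm \<xi>)\<^sup>2) powr (- \<alpha>))"
    using Gnz by simp
qed

end

theory Submission
  imports Defs
begin

text \<open>
  Put \<open>a = CARD('n) / 2\<close>, \<open>r = (norm x)\<^sup>2 / 4\<close> and \<open>\<beta> = \<alpha> - a\<close>. For \<open>\<alpha> > a + 1\<close>, the kernel is
  \<open>(4 * pi) powr (-a) / Gamma \<alpha>\<close> times the integral of \<open>exp (- lambda * t) * t powr (\<beta> - 1)\<close> against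
  \<open>exp (- r / t)\<close>, that is, \<open>Gamma \<beta> * lambda powr (-\<beta>)\<close> times the expectation of \<open>exp (- r / T)\<close>,
  where \<open>T\<close> is Gamma distributed with shape \<open>\<beta>\<close> and rate \<open>lambda\<close>. Dividing by
  \<open>lambda powr (-\<alpha>) * heat_kernel (\<alpha> / lambda) x\<close> leaves a product of three factors:

  \<^item> \<open>Gamma \<beta> * \<alpha> powr a / Gamma \<alpha>\<close>, which lies between \<open>1\<close> and \<open>exp (a * (a + 1) / (\<alpha> - a - 1))\<close>
    because \<open>ln Gamma\<close> is convex and grows by \<open>ln y\<close> from \<open>y\<close> to \<open>y + 1\<close>;
  \<^item> the expectation of \<open>exp (- r / T)\<close>, which lies between \<open>1 - r * lambda / (\<beta> - 1)\<close> and \<open>1\<close>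
    because \<open>exp (-u) \<ge> 1 - u\<close> and \<open>1 / T\<close> has mean \<open>lambda / (\<beta> - 1)\<close>;
  \<^item> \<open>exp (lambda * r / \<alpha>)\<close>, which is at least \<open>1\<close>.

  Only the second factor can fall below \<open>1\<close>, and only the other two can exceed it. Each is within
  \<open>O(1 / \<alpha>)\<close> of \<open>1\<close>, with a constant that depends on \<open>x\<close> only through an upper bound for \<open>r\<close>.
  This gives uniformity on every bounded set, the origin included. Gautschi-type inequalities for
  \<open>Gamma\<close> take the place of Laplace's method at the peak of the integrand.
\<close>

section \<open>Ratios of Gamma values\<close>

lemma Gamma_plus1_pos:
  fixes z :: real
  assumes "z > 0"
  shows "Gamma (z + 1) = z * Gamma z"
proof (rule Gamma_plus1)
  show "z \<notin> \<int>\<^sub>\<le>\<^sub>0" using assms by (auto elim!: nonpos_Ints_cases)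
qed

text \<open>Log-convexity: the slope of \<open>ln Gamma\<close> over \<open>[x, y]\<close> lies between its slopes over the
  adjacent unit intervals \<open>[x - 1, x]\<close> and \<open>[y, y + 1]\<close>, and these equal \<open>ln (x - 1)\<close> and \<open>ln y\<close>
  by the functional equation.\<close>

lemma Gamma_ratio_bounds:
  fixes x y :: real
  assumes "1 < x" "x < y"
  shows "(x - 1) powr (y - x) \<le> Gamma y / Gamma x"
    and "Gamma y / Gamma x \<le> y powr (y - x)"
proof -
  define L where "L = (ln \<circ> Gamma :: real \<Rightarrow> real)"
  have cvx: "convex_on {0<..} L" unfolding L_def by (rule log_convex_Gamma_real)
  have step: "L (z + 1) - L z = ln z" if "z > 0" for z
  proof -
    have "Gamma z \<noteq> 0" using Gamma_real_pos[OF that] by linarith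
    thus ?thesis using that by (simp add: L_def Gamma_plus1_pos ln_mult)
  qed
  have pos: "Gamma x > 0" "Gamma y > 0" using assms by (auto intro: Gamma_real_pos)
  have ratio: "Gamma y / Gamma x = exp (L y - L x)"
    using pos by (simp add: L_def exp_diff)
  have "(L (x - 1) - L x) / ((x - 1) - x) \<le> (L x - L y) / (x - y)"
    using assms convex_on_slope_le[OF cvx, of "x - 1" y x] by auto
  hence "ln (x - 1) * (y - x) \<le> L y - L x"
    using assms step[of "x - 1"] by (simp add: field_simps)
  thus "(x - 1) powr (y - x) \<le> Gamma y / Gamma x"
    using assms by (simp add: ratio powr_def mult.commute)
  have "(L x - L y) / (x - y) \<le> (L y - L (y + 1)) / (y - (y + 1))"
    using assms convex_on_slope_le[OF cvx, of x "y + 1" y] by auto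
  hence "L y - L x \<le> ln y * (y - x)"
    using assms step[of y] by (simp add: field_simps)
  thus "Gamma y / Gamma x \<le> y powr (y - x)"
    using assms by (simp add: ratio powr_def mult.commute)
qed

section \<open>The Gamma average of an inverse exponential\<close>

text \<open>The upper bound is \<open>exp (- r / t) \<le> 1\<close>. The lower bound is \<open>exp (- r / t) \<ge> 1 - r / t\<close>, where
  the extra factor \<open>1 / t\<close> lowers the shape of the Gamma integral by one.\<close>

lemma Gamma_integral_inverse_exp_bounds:
  fixes \<beta> s r :: real
  assumes "\<beta> > 1" "s > 0" "r \<ge> 0"
  defines "J \<equiv> (LBINT t:{0<..}. exp (- s * t) * t powr (\<beta> - 1) * exp (- (r / t)))"
  shows "J \<le> Gamma \<beta> * s powr (-\<beta>)"
    and "Gamma \<beta> * s powr (-\<beta>) * (1 - r * s / (\<beta> - 1)) \<le> J"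
proof -
  define w where "w b t = indicator {0<..} t * (exp (- s * t) * t powr (b - 1))" for b t :: real
  define f where "f t = w \<beta> t * exp (- (r / t))" for t
  have w: "has_bochner_integral lborel (w b) (Gamma b * s powr (-b))" if "b > 0" for b
    using has_bochner_integral_Gamma_scaled[OF that assms(2)] by (simp add: w_def[abs_def])
  have w1: "has_bochner_integral lborel (w \<beta>) (Gamma \<beta> * s powr (-\<beta>))"
    and w2: "has_bochner_integral lborel (w (\<beta> - 1)) (Gamma (\<beta> - 1) * s powr (-(\<beta> - 1)))"
    using w[of \<beta>] w[of "\<beta> - 1"] assms(1) by simp_all
  have [measurable]: "w b \<in> borel_measurable borel" for b unfolding w_def by measurable
  have [measurable]: "f \<in> borel_measurable borel" unfolding f_def by measurable
  have upper: "f t \<le> w \<beta> t" and nonneg: "f t \<ge> 0" for t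
    using assms by (auto simp: f_def w_def indicator_def mult_left_le)
  have lower: "w \<beta> t - r * w (\<beta> - 1) t \<le> f t" for t
  proof (cases "t > 0")
    case True
    have "w \<beta> t - r * w (\<beta> - 1) t = w \<beta> t * (1 - r / t)"
      using True powr_diff[of t "\<beta> - 1" 1] by (simp add: w_def field_simps)
    also have "\<dots> \<le> w \<beta> t * exp (- (r / t))"
      using exp_ge_add_one_self[of "- (r / t)"] True
      by (intro mult_left_mono) (auto simp: w_def)
    finally show ?thesis by (simp add: f_def)
  qed (simp add: w_def f_def)
  have int: "integrable lborel f"
    using upper nonneg
    by (intro Bochner_Integration.integrable_bound[OF integrable.intros[OF w1], of f] AE_I2)
       (auto intro: order_trans[OF _ abs_ge_self])
  have J: "J = integral\<^sup>L lborel f"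
    by (simp add: J_def f_def[abs_def] w_def set_lebesgue_integral_def mult.assoc)
  show "J \<le> Gamma \<beta> * s powr (-\<beta>)"
    unfolding J has_bochner_integral_integral_eq[OF w1, symmetric]
    using int w1 upper by (intro integral_mono) (auto intro: integrable.intros)
  have G: "Gamma \<beta> = (\<beta> - 1) * Gamma (\<beta> - 1)"
    using Gamma_plus1_pos[of "\<beta> - 1"] \<open>\<beta> > 1\<close> by simp
  have p: "s powr (-(\<beta> - 1)) = s * s powr (-\<beta>)"
    using assms powr_add[of s "-\<beta>" 1] by simp
  have "Gamma \<beta> * s powr (-\<beta>) * (1 - r * s / (\<beta> - 1))
      = Gamma \<beta> * s powr (-\<beta>) - r * (Gamma (\<beta> - 1) * s powr (-(\<beta> - 1)))"
    unfolding G p using \<open>\<beta> > 1\<close> by (simp add: field_simps)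
  also have "\<dots> = (\<integral>t. w \<beta> t - r * w (\<beta> - 1) t \<partial>lborel)"
    by (intro has_bochner_integral_integral_eq[symmetric] has_bochner_integral_diff
          has_bochner_integral_mult_right w1 w2)
  also have "\<dots> \<le> J"
    unfolding J using int lower integrable.intros[OF w1] integrable.intros[OF w2]
    by (intro integral_mono) auto
  finally show "Gamma \<beta> * s powr (-\<beta>) * (1 - r * s / (\<beta> - 1)) \<le> J" .
qed

section \<open>The kernel relative to its leading term\<close>

lemma heat_kernel_rescaled:
  fixes x :: "real ^ 'n"
  assumes "lambda > 0"
  shows "heat_kernel (\<alpha> / lambda) x
    = (4 * pi * \<alpha> / lambda) powr (- real CARD('n) / 2) * exp (- (lambda * (norm x)\<^sup>2 / (4 * \<alpha>)))"
  using assms by (simp add: heat_kernel_def mult.commute)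

lemma heat_kernel_pos: "t > 0 \<Longrightarrow> heat_kernel t x > 0"
  by (simp add: heat_kernel_def)

lemma shifted_bessel_kernel_eq_Gamma_integral:
  fixes x :: "real ^ 'n"
  defines "a \<equiv> real CARD('n) / 2"
  shows "shifted_bessel_kernel lambda \<alpha> x = (4 * pi) powr (-a) / Gamma \<alpha> *
    (LBINT t:{0<..}. exp (- lambda * t) * t powr (\<alpha> - a - 1) * exp (- ((norm x)\<^sup>2 / 4 / t)))"
proof -
  have "indicator {0<..} t *\<^sub>R (exp (- lambda * t) * t powr (\<alpha> - 1) * heat_kernel t x)
     = (4 * pi) powr (-a) *
       (indicator {0<..} t *\<^sub>R (exp (- lambda * t) * t powr (\<alpha> - a - 1) * exp (- ((norm x)\<^sup>2 / 4 / t))))"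
    for t :: real
  proof (cases "t > 0")
    case True
    have "t powr (\<alpha> - a - 1) = t powr (\<alpha> - 1) * t powr (-a)"
      by (simp flip: powr_add add: algebra_simps)
    thus ?thesis using True
      by (simp add: heat_kernel_def a_def powr_mult)
  qed simp
  thus ?thesis
    unfolding shifted_bessel_kernel_def set_lebesgue_integral_def by (simp only:) simp
qed

text \<open>The three factors described above, with \<open>P\<close> the quotient of Gamma values, \<open>Q\<close> the Gamma
  average and \<open>S\<close> the reciprocal of the exponential in the heat kernel.\<close>

lemma shifted_bessel_kernel_ratio_bounds:
  fixes x :: "real ^ 'n"
  assumes "lambda > 0"
  defines "a \<equiv> real CARD('n) / 2" and "r \<equiv> (norm x)\<^sup>2 / 4"
  defines "q \<alpha> \<equiv> shifted_bessel_kernel lambda \<alpha> x / (lambda powr (-\<alpha>) * heat_kernel (\<alpha> / lambda) x)"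
  assumes "\<alpha> > a + 1"
  shows "1 - r * lambda / (\<alpha> - a - 1) \<le> q \<alpha>"
    and "q \<alpha> \<le> exp (a * (a + 1) / (\<alpha> - a - 1) + lambda * r / \<alpha>)"
proof -
  have a: "a > 0" unfolding a_def by simp
  have r: "r \<ge> 0" unfolding r_def by simp
  define \<beta> where "\<beta> = \<alpha> - a"
  have \<beta>: "\<beta> > 1" "\<beta> < \<alpha>" "\<alpha> > 0" using assms a by (auto simp: \<beta>_def)
  define J where "J = (LBINT t:{0<..}. exp (- lambda * t) * t powr (\<beta> - 1) * exp (- (r / t)))"
  define P where "P = Gamma \<beta> * \<alpha> powr a / Gamma \<alpha>"
  define Q where "Q = J / (Gamma \<beta> * lambda powr (-\<beta>))"
  define S where "S = exp (lambda * r / \<alpha>)"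
  have G: "Gamma \<alpha> > 0" "Gamma \<beta> > 0" using \<beta> by (auto intro: Gamma_real_pos)
  have D: "Gamma \<beta> * lambda powr (-\<beta>) > 0" using G assms by simp
  have q: "q \<alpha> = P * Q * S"
  proof -
    have k: "shifted_bessel_kernel lambda \<alpha> x = (4 * pi) powr (-a) / Gamma \<alpha> * J"
      unfolding J_def r_def \<beta>_def a_def by (rule shifted_bessel_kernel_eq_Gamma_integral)
    have S: "exp (- (lambda * (norm x)\<^sup>2 / (4 * \<alpha>))) = 1 / S"
      by (simp add: S_def r_def exp_minus field_simps)
    have "(4 * pi * \<alpha> / lambda) powr (-a) = (4 * pi) powr (-a) * (\<alpha> powr (-a) * lambda powr a)"
      using assms \<beta> by (simp add: powr_mult powr_divide powr_minus field_simps)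
    hence h: "heat_kernel (\<alpha> / lambda) x = (4 * pi) powr (-a) * (\<alpha> powr (-a) * lambda powr a) / S"
      unfolding heat_kernel_rescaled[OF assms(1)] S by (simp add: a_def)
    have l: "lambda powr (-\<beta>) = lambda powr (-\<alpha>) * lambda powr a"
      by (simp add: \<beta>_def flip: powr_add)
    have nz: "S > 0" "(4 * pi) powr (-a) > 0" "\<alpha> powr a > 0" "lambda powr a > 0" "lambda powr (-\<alpha>) > 0"
      using assms \<beta> by (auto simp: S_def)
    show ?thesis
      unfolding q_def k h P_def Q_def l powr_minus[of \<alpha> a] using nz G by (simp add: field_simps)
  qed
  have J: "J \<le> Gamma \<beta> * lambda powr (-\<beta>)"
      "Gamma \<beta> * lambda powr (-\<beta>) * (1 - r * lambda / (\<beta> - 1)) \<le> J"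
    unfolding J_def by (rule Gamma_integral_inverse_exp_bounds[OF \<beta>(1) assms(1) r])+
  have J0: "J \<ge> 0" unfolding J_def set_lebesgue_integral_def
    by (intro integral_nonneg_AE AE_I2) (auto simp: indicator_def)
  have Q: "Q \<le> 1" "1 - r * lambda / (\<beta> - 1) \<le> Q" "Q \<ge> 0"
    using J J0 D by (auto simp: Q_def pos_le_divide_eq mult.commute)
  have S: "S \<ge> 1" using assms r \<beta> by (simp add: S_def)
  have P1: "P \<ge> 1"
    using Gamma_ratio_bounds(2)[OF \<beta>(1,2)] G by (simp add: P_def \<beta>_def field_simps)
  have P2: "P \<le> exp (a * (a + 1) / (\<alpha> - a - 1))"
  proof -
    have "(\<beta> - 1) powr a \<le> Gamma \<alpha> / Gamma \<beta>"
      using Gamma_ratio_bounds(1)[OF \<beta>(1,2)] by (simp add: \<beta>_def)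
    hence "P \<le> (\<alpha> / (\<beta> - 1)) powr a"
      using \<beta> G by (simp add: P_def powr_divide field_simps)
    also have "\<alpha> / (\<beta> - 1) = 1 + (a + 1) / (\<beta> - 1)"
      using \<beta> by (simp add: \<beta>_def field_simps)
    also have "\<dots> powr a \<le> exp ((a + 1) / (\<beta> - 1)) powr a"
      using a \<beta> by (intro powr_mono2 exp_ge_add_one_self) auto
    also have "\<dots> = exp (a * (a + 1) / (\<alpha> - a - 1))"
      by (simp add: powr_def \<beta>_def)
    finally show ?thesis .
  qed
  have "1 * Q * 1 \<le> P * Q * S" using P1 Q S by (intro mult_mono) auto
  thus "1 - r * lambda / (\<alpha> - a - 1) \<le> q \<alpha>" using Q(2) by (simp add: q \<beta>_def)
  have "P * Q * S \<le> exp (a * (a + 1) / (\<alpha> - a - 1)) * 1 * S"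
    using P1 P2 Q S by (intro mult_mono) auto
  thus "q \<alpha> \<le> exp (a * (a + 1) / (\<alpha> - a - 1) + lambda * r / \<alpha>)"
    by (simp add: q S_def exp_add)
qed

text \<open>With \<open>u = M / \<alpha>\<close>, this turns the bound \<open>exp (M / \<alpha>)\<close> into \<open>1 + O(1 / \<alpha>)\<close>. It is
  \<open>exp (-u) \<ge> 1 - u\<close> multiplied by \<open>exp u\<close>.\<close>

lemma exp_minus_one_le:
  fixes u :: real
  shows "exp u - 1 \<le> u * exp u"
proof -
  have "exp u * (1 - u) \<le> exp u * exp (- u)"
    using exp_ge_add_one_self[of "- u"] by (intro mult_left_mono) auto
  thus ?thesis by (simp add: algebra_simps flip: exp_add)
qed

text \<open>The threshold \<open>CARD('n) + 2\<close> is \<open>2 * (a + 1)\<close> for \<open>a = CARD('n) / 2\<close>, so that \<open>\<alpha> - a - 1\<close>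
  is at least \<open>\<alpha> / 2\<close> and both bounds become multiples of \<open>1 / \<alpha>\<close>.\<close>

lemma shifted_bessel_kernel_ratio_uniform:
  fixes R lambda :: real
  assumes "lambda > 0" "R \<ge> 0"
  shows "\<exists>C. \<forall>\<alpha> \<ge> real CARD('n) + 2. \<forall>x :: real ^ 'n. norm x \<le> R \<longrightarrow>
    \<bar>shifted_bessel_kernel lambda \<alpha> x / (lambda powr (-\<alpha>) * heat_kernel (\<alpha> / lambda) x) - 1\<bar> \<le> C / \<alpha>"
proof (intro exI allI impI)
  define a where "a = real CARD('n) / 2"
  define r where "r = R\<^sup>2 / 4"
  define M where "M = 2 * a * (a + 1) + lambda * r"
  fix \<alpha> :: real and x :: "real ^ 'n"
  assume \<alpha>: "real CARD('n) + 2 \<le> \<alpha>" and x: "norm x \<le> R"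
  define q where "q = shifted_bessel_kernel lambda \<alpha> x / (lambda powr (-\<alpha>) * heat_kernel (\<alpha> / lambda) x)"
  have a: "a > 0" by (simp add: a_def)
  have A: "\<alpha> \<ge> 2 * (a + 1)" "\<alpha> > a + 1" "\<alpha> \<ge> 1" using \<alpha> a by (auto simp: a_def)
  have r: "(norm x)\<^sup>2 / 4 \<le> r" "r \<ge> 0" using x by (auto simp: r_def power_mono)
  have half: "1 / (\<alpha> - a - 1) \<le> 2 / \<alpha>" using A a by (simp add: field_simps)
  note ratio = shifted_bessel_kernel_ratio_bounds[OF assms(1), of \<alpha> x,
      folded a_def, OF A(2), folded q_def]
  have "(norm x)\<^sup>2 / 4 * lambda * (1 / (\<alpha> - a - 1)) \<le> r * lambda * (2 / \<alpha>)"
    using r assms half A by (intro mult_mono) auto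
  also have "\<dots> = 2 * r * lambda / \<alpha>" by simp
  finally have low: "1 - 2 * r * lambda / \<alpha> \<le> q" using ratio(1) by simp
  have "a * (a + 1) * (1 / (\<alpha> - a - 1)) + lambda * ((norm x)\<^sup>2 / 4) * (1 / \<alpha>)
      \<le> a * (a + 1) * (2 / \<alpha>) + lambda * r * (1 / \<alpha>)"
    using a r assms half A by (intro add_mono mult_mono) auto
  also have "\<dots> = M / \<alpha>" using A by (simp add: M_def field_simps)
  finally have "q \<le> exp (M / \<alpha>)"
    by (simp add: order_trans[OF ratio(2)])
  moreover have M: "M \<ge> 0" using a assms r by (simp add: M_def)
  have "exp (M / \<alpha>) - 1 \<le> M / \<alpha> * exp M"
  proof -
    have "M / \<alpha> \<le> M" using A M by (simp add: divide_le_eq mult_le_cancel_left1)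
    hence "M / \<alpha> * exp (M / \<alpha>) \<le> M / \<alpha> * exp M" using M A by (intro mult_left_mono) auto
    thus ?thesis using exp_minus_one_le[of "M / \<alpha>"] by linarith
  qed
  ultimately have up: "q - 1 \<le> M * exp M / \<alpha>" by simp
  have "M * exp M / \<alpha> \<ge> 0" "2 * r * lambda / \<alpha> \<ge> 0" using M A r assms by auto
  hence "\<bar>q - 1\<bar> \<le> M * exp M / \<alpha> + 2 * r * lambda / \<alpha>" using low up by (simp add: abs_le_iff)
  thus "\<bar>q - 1\<bar> \<le> (M * exp M + 2 * r * lambda) / \<alpha>" by (simp add: add_divide_distrib)
qed

text \<open>The error is the quotient by the leading term minus one, so both identities hold by
  construction.\<close>

theorem proposition1p1:
  fixes lambda :: real
  assumes "lambda > 0"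
  shows "\<exists>E :: real \<Rightarrow> real ^ 'n \<Rightarrow> real.
    (\<forall>x. x \<noteq> 0 \<longrightarrow>
      (\<forall>\<alpha>>0. shifted_bessel_kernel lambda \<alpha> x
                = lambda powr (-\<alpha>) * heat_kernel (\<alpha> / lambda) x * (1 + E \<alpha> x)) \<and>
      (\<forall>\<alpha>>0. shifted_bessel_kernel lambda \<alpha> x
                = lambda powr (-\<alpha>) * (4 * pi * \<alpha> / lambda) powr (- real CARD('n) / 2)
                    * exp (- (lambda * (norm x)\<^sup>2 / (4 * \<alpha>))) * (1 + E \<alpha> x)) \<and>
      (\<lambda>\<alpha>. E \<alpha> x) \<in> O[at_top](\<lambda>\<alpha>. 1 / \<alpha>)) \<and>
    (\<forall>K. compact K \<longrightarrow>
      (\<exists>C A. 0 < A \<and> (\<forall>\<alpha>\<ge>A. \<forall>x\<in>K.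
          shifted_bessel_kernel lambda \<alpha> x
            = lambda powr (-\<alpha>) * heat_kernel (\<alpha> / lambda) x * (1 + E \<alpha> x) \<and>
          shifted_bessel_kernel lambda \<alpha> x
            = lambda powr (-\<alpha>) * (4 * pi * \<alpha> / lambda) powr (- real CARD('n) / 2)
                * exp (- (lambda * (norm x)\<^sup>2 / (4 * \<alpha>))) * (1 + E \<alpha> x) \<and>
          \<bar>E \<alpha> x\<bar> \<le> C / \<alpha>)))"
proof -
  define E :: "real \<Rightarrow> real ^ 'n \<Rightarrow> real" where
    "E \<alpha> x = shifted_bessel_kernel lambda \<alpha> x / (lambda powr (-\<alpha>) * heat_kernel (\<alpha> / lambda) x) - 1"
    for \<alpha> x
  have eq1: "shifted_bessel_kernel lambda \<alpha> x
      = lambda powr (-\<alpha>) * heat_kernel (\<alpha> / lambda) x * (1 + E \<alpha> x)" if "\<alpha> > 0" for \<alpha> x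
    using that assms heat_kernel_pos[of "\<alpha> / lambda" x] by (simp add: E_def)
  have eq2: "shifted_bessel_kernel lambda \<alpha> x
      = lambda powr (-\<alpha>) * (4 * pi * \<alpha> / lambda) powr (- real CARD('n) / 2)
          * exp (- (lambda * (norm x)\<^sup>2 / (4 * \<alpha>))) * (1 + E \<alpha> x)" if "\<alpha> > 0" for \<alpha> x
    using eq1[OF that, of x] unfolding heat_kernel_rescaled[OF assms] by (simp only: mult.assoc)
  have bound: "\<exists>C. \<forall>\<alpha> \<ge> real CARD('n) + 2. \<forall>x\<in>K. \<bar>E \<alpha> x\<bar> \<le> C / \<alpha>" if K: "bounded K" for K
  proof -
    obtain R where "R > 0" "\<forall>x\<in>K. norm x \<le> R" using K by (auto simp: bounded_pos)
    thus ?thesis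
      using shifted_bessel_kernel_ratio_uniform[OF assms, of R, where 'n = 'n]
      unfolding E_def by (meson less_imp_le)
  qed
  have "(\<lambda>\<alpha>. E \<alpha> x) \<in> O[at_top](\<lambda>\<alpha>. 1 / \<alpha>)" for x
  proof -
    obtain C where C: "\<forall>\<alpha> \<ge> real CARD('n) + 2. \<bar>E \<alpha> x\<bar> \<le> C / \<alpha>"
      using bound[of "{x}"] by auto
    show ?thesis
    proof (rule bigoI)
      show "\<forall>\<^sub>F \<alpha> in at_top. norm (E \<alpha> x) \<le> C * norm (1 / \<alpha>)"
        using eventually_ge_at_top[of "real CARD('n) + 2"]
        by eventually_elim (use C in auto)
    qed
  qed
  moreover have "\<exists>C A. 0 < A \<and> (\<forall>\<alpha>\<ge>A. \<forall>x\<in>K.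
      shifted_bessel_kernel lambda \<alpha> x
        = lambda powr (-\<alpha>) * heat_kernel (\<alpha> / lambda) x * (1 + E \<alpha> x) \<and>
      shifted_bessel_kernel lambda \<alpha> x
        = lambda powr (-\<alpha>) * (4 * pi * \<alpha> / lambda) powr (- real CARD('n) / 2)
            * exp (- (lambda * (norm x)\<^sup>2 / (4 * \<alpha>))) * (1 + E \<alpha> x) \<and>
      \<bar>E \<alpha> x\<bar> \<le> C / \<alpha>)" if K: "compact K" for K
  proof -
    obtain C where "\<forall>\<alpha> \<ge> real CARD('n) + 2. \<forall>x\<in>K. \<bar>E \<alpha> x\<bar> \<le> C / \<alpha>"
      using bound[OF compact_imp_bounded[OF K]] by blast
    thus ?thesis
      by (intro exI[of _ C] exI[of _ "real CARD('n) + 2"] conjI allI impI ballI eq1 eq2) auto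
  qed
  ultimately show ?thesis using eq1 eq2 by (intro exI[of _ E]) blast
qed

end
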